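(* Let $G$ be a countable group acting by an action $T$ by measure-preserving transformations on a standard probability space $\mathbf{X}=(X,\mathscr{X},\mu)$. Consider the family of all complete $T$-invariant $\sigma$-subalgebras $\mathscr{A}\subseteq\mathscr{X}$ whose Rokhlin entropy $h(\mathscr{A})$ equals $0$, ordered by inclusion. Then this family has a unique maximal element (called the Pinsker subalgebra of $(\mathbf{X},T)$ with respect to Rokhlin entropy).
   Context: A standard probability space (Lebesgue space) is the (completed) measure space arising from a Borel probability measure on a standard Borel space. A dynamical system is a pair $(\mathbf{X},T)$ where $\mathbf{X}=(X,\mathscr{X},\mu)$ is a standard probability space and $T$ is an action of a countable group $G$ on it by measure-preserving transformations $T^g$, $g\in G$. A $\sigma$-subalgebra $\mathscr{A}\subseteq\mathscr{X}$ is complete if $A\in\mathscr{A}$, $B\in\mathscr{X}$ and $\mu(A\Delta B)=0$ imply $B\in\mathscr{A}$. It is invariant if $T^g(A)\in\mathscr{A}$ for all $A\in\mathscr{A}$ and $g\in G$. A partition is a finite or countable collection of disjoint measurable subsets of $X$ covering $X$; it is $\mathscr{A}$-measurable if all its elements belong to $\mathscr{A}$. The Shannon entropy of a partition $\alpha=\{A_1,A_2,\ldots\}$ is $H(\alpha)=-\sum_i\mu(A_i)\log\mu(A_i)\in[0,\infty]$, with $0\log 0=0$. A partition $\alpha$ generates the smallest complete invariant $\sigma$-subalgebra with respect to which $\alpha$ is measurable. The Rokhlin entropy of a complete invariant $\sigma$-subalgebra $\mathscr{A}$ is $h(\mathscr{A})=\inf\{H(\alpha):\alpha \text{ is an } \mathscr{A}\text{-measurable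 partition generating } \mathscr{A}\}\in[0,\infty]$, where the infimum of the empty set is $+\infty$. *)

theory Defs
  imports "HOL-Probability.Probability" "HOL-Algebra.Group_Action"
begin

text \<open>The carrier of a standard Borel space need not be a whole type, so its topology is an
  abstract topology on \<open>space N\<close>, not one given by the class \<open>polish_space\<close>.\<close>

definition standard_borel_space :: "'a measure \<Rightarrow> bool" where
  "standard_borel_space N \<longleftrightarrow>
     (\<exists>X. completely_metrizable_space X \<and> second_countable X \<and> topspace X = space N \<and>
          sets N = sigma_sets (space N) {U. openin X U})"

definition standard_probability_space :: "'a measure \<Rightarrow> bool" where
  "standard_probability_space M \<longleftrightarrow>
     (\<exists>N. standard_borel_space N \<and> prob_space N \<and> M = completion N)"

definition measure_preserving_map :: "'a measure \<Rightarrow> ('a \<Rightarrow> 'a) \<Rightarrow> bool" where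
  "measure_preserving_map M f \<longleftrightarrow>
     f \<in> measurable M M \<and> (\<forall>A\<in>sets M. emeasure M (f -` A \<inter> space M) = emeasure M A)"

text \<open>The library locale \<open>group_action\<close> provides the group axioms for \<open>G\<close>
  and makes \<open>T\<close> a homomorphism into the bijections of \<open>space M\<close>; it holds pointwise,
  not just almost everywhere. Functions in that group are \<open>undefined\<close> outside \<open>space M\<close>.\<close>

definition dynamical_system ::
    "('g, 'm) monoid_scheme \<Rightarrow> 'a measure \<Rightarrow> ('g \<Rightarrow> 'a \<Rightarrow> 'a) \<Rightarrow> bool" where
  "dynamical_system G M T \<longleftrightarrow>
     standard_probability_space M \<and> countable (carrier G) \<and>
     group_action G (space M) T \<and> (\<forall>g\<in>carrier G. measure_preserving_map M (T g))"

text \<open>Sigma-subalgebras are plain families of sets: as \<open>measure\<close> objects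
  (library notion \<open>subalgebra\<close>) they would carry a superfluous measure and
  not be determined by their measurable sets.\<close>

definition sigma_subalgebra :: "'a measure \<Rightarrow> 'a set set \<Rightarrow> bool" where
  "sigma_subalgebra M \<A> \<longleftrightarrow> sigma_algebra (space M) \<A> \<and> \<A> \<subseteq> sets M"

definition complete_subalgebra :: "'a measure \<Rightarrow> 'a set set \<Rightarrow> bool" where
  "complete_subalgebra M \<A> \<longleftrightarrow>
     (\<forall>A\<in>\<A>. \<forall>B\<in>sets M. emeasure M ((A - B) \<union> (B - A)) = 0 \<longrightarrow> B \<in> \<A>)"

definition invariant_subalgebra ::
    "('g, 'm) monoid_scheme \<Rightarrow> ('g \<Rightarrow> 'a \<Rightarrow> 'a) \<Rightarrow> 'a set set \<Rightarrow> bool" where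
  "invariant_subalgebra G T \<A> \<longleftrightarrow> (\<forall>A\<in>\<A>. \<forall>g\<in>carrier G. T g ` A \<in> \<A>)"

definition complete_invariant_subalgebras ::
    "('g, 'm) monoid_scheme \<Rightarrow> 'a measure \<Rightarrow> ('g \<Rightarrow> 'a \<Rightarrow> 'a) \<Rightarrow> 'a set set set" where
  "complete_invariant_subalgebras G M T =
     {\<A>. sigma_subalgebra M \<A> \<and> complete_subalgebra M \<A> \<and> invariant_subalgebra G T \<A>}"

definition countable_partition :: "'a measure \<Rightarrow> 'a set set \<Rightarrow> bool" where
  "countable_partition M \<alpha> \<longleftrightarrow>
     countable \<alpha> \<and> \<alpha> \<subseteq> sets M \<and> disjoint \<alpha> \<and> \<Union>\<alpha> = space M"

text \<open>Each summand is nonnegative because measures are at most 1, and \<open>0 * ln 0 = 0\<close>. The sum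
  is taken in \<open>ennreal\<close>, where it always exists.\<close>

definition shannon_entropy :: "'a measure \<Rightarrow> 'a set set \<Rightarrow> ennreal" where
  "shannon_entropy M \<alpha> = (\<Sum>\<^sub>\<infinity>A\<in>\<alpha>. ennreal (- (measure M A * ln (measure M A))))"

text \<open>\<open>\<A>\<close> is the smallest complete invariant sigma-subalgebra containing \<open>\<alpha>\<close>.\<close>

definition generates ::
    "('g, 'm) monoid_scheme \<Rightarrow> 'a measure \<Rightarrow> ('g \<Rightarrow> 'a \<Rightarrow> 'a) \<Rightarrow> 'a set set \<Rightarrow> 'a set set \<Rightarrow> bool" where
  "generates G M T \<alpha> \<A> \<longleftrightarrow>
     \<A> \<in> complete_invariant_subalgebras G M T \<and> \<alpha> \<subseteq> \<A> \<and>
     (\<forall>\<B>\<in>complete_invariant_subalgebras G M T. \<alpha> \<subseteq> \<B> \<longrightarrow> \<A> \<subseteq> \<B>)"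

text \<open>The infimum of the empty set in \<open>ennreal\<close> is \<open>\<infinity>\<close>.\<close>

definition rokhlin_entropy ::
    "('g, 'm) monoid_scheme \<Rightarrow> 'a measure \<Rightarrow> ('g \<Rightarrow> 'a \<Rightarrow> 'a) \<Rightarrow> 'a set set \<Rightarrow> ennreal" where
  "rokhlin_entropy G M T \<A> =
     Inf {shannon_entropy M \<alpha> | \<alpha>. countable_partition M \<alpha> \<and> \<alpha> \<subseteq> \<A> \<and> generates G M T \<alpha> \<A>}"

definition zero_entropy_subalgebras ::
    "('g, 'm) monoid_scheme \<Rightarrow> 'a measure \<Rightarrow> ('g \<Rightarrow> 'a \<Rightarrow> 'a) \<Rightarrow> 'a set set set" where
  "zero_entropy_subalgebras G M T =
     {\<A> \<in> complete_invariant_subalgebras G M T. rokhlin_entropy G M T \<A> = 0}"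

end

theory Submission
  imports Defs
begin

text \<open>The family has a greatest element, for two reasons.

  The join of countably many zero-entropy subalgebras has zero entropy. Choose generating partitions
  of total entropy at most \<open>e\<close> and list their cells of measure at most \<open>1/2\<close> as \<open>C 0, C 1, \<dots>\<close>; these
  cells determine the partitions and their measures sum to at most \<open>2 * e\<close>. By Borel-Cantelli almost
  every point lies in only finitely many \<open>C k\<close>, so the partition by the signature \<open>{k. x \<in> C k}\<close> is
  countable up to a null set. It generates the join, and Gibbs' inequality bounds its entropy by
  \<open>e + exp (2 * e) - 1\<close>.

  Sets modulo null sets form a separable metric space under the measure of the symmetric difference.
  Hence countably many zero-entropy subalgebras contain a dense subset of the union of all of them,
  and their join, being complete and therefore closed, contains every zero-entropy subalgebra.\<close>

subsection \<open>The partition by signatures\<close>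

text \<open>Gibbs' inequality for one term, from \<open>ln t \<le> t - 1\<close> at
  \<open>t = q / p\<close>. The summand \<open>q - p\<close> stays in the bound, so the weights
  \<open>q\<close> may have any total mass. For \<open>p = 0\<close> only \<open>0 \<le> q\<close>
  remains.\<close>

lemma entropy_term_le:
  fixes p q :: real
  assumes "0 \<le> p" "0 \<le> q" "q = 0 \<Longrightarrow> p = 0"
  shows "- (p * ln p) \<le> p * (- ln q) + q - p"
proof (cases "p = 0")
  case False
  then have pos: "0 < p" "0 < q" using assms by (auto simp: less_le)
  have "p * ln (q / p) \<le> p * (q / p - 1)"
    using pos by (intro mult_left_mono ln_le_minus_one) auto
  also have "\<dots> = q - p" using pos by (simp add: field_simps)
  finally show ?thesis using pos by (simp add: ln_div algebra_simps)
qed (use assms in simp)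

text \<open>The cells are the fibres of the map \<open>x \<mapsto> {k. x \<in> C k}\<close>, hence
  disjoint for distinct \<open>F\<close>; some may be empty.\<close>

definition signature_cell :: "'a measure \<Rightarrow> (nat \<Rightarrow> 'a set) \<Rightarrow> nat set \<Rightarrow> 'a set" where
  "signature_cell M C F = {x \<in> space M. \<forall>k. x \<in> C k \<longleftrightarrow> k \<in> F}"

lemma disjoint_family_signature_cell: "disjoint_family_on (signature_cell M C) \<F>"
  by (auto simp: disjoint_family_on_def signature_cell_def)

lemma sets_signature_cell:
  assumes C: "\<And>k. C k \<in> sets M"
  shows "signature_cell M C F \<in> sets M"
proof -
  have "signature_cell M C F
      = (space M - (\<Union>k\<in>- F. C k)) - (\<Union>k\<in>F. space M - C k)"
    by (auto simp: signature_cell_def)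
  also have "\<dots> \<in> sets M"
    using C by (intro sets.Diff sets.countable_UN'' sets.top) auto
  finally show ?thesis .
qed

section \<open>Entropy of the signature cells\<close>

context prob_space
begin

text \<open>The cells with signature inside \<open>{..<n}\<close> are disjoint and together consist
  of the points that avoid every \<open>C k\<close> with \<open>n \<le> k\<close>.\<close>

lemma sum_prob_signature_cell_Pow:
  assumes C: "\<And>k. C k \<in> sets M"
  shows "(\<Sum>F\<in>Pow {..<n}. prob (signature_cell M C F)) = prob (space M - (\<Union>k. C (n + k)))"
proof -
  have "(\<Sum>F\<in>Pow {..<n}. prob (signature_cell M C F)) = prob (\<Union>F\<in>Pow {..<n}. signature_cell M C F)"
    using C by (intro finite_measure_finite_Union[symmetric] disjoint_family_signature_cell)
      (auto intro: sets_signature_cell)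
  also have "(\<Union>F\<in>Pow {..<n}. signature_cell M C F) = space M - (\<Union>k. C (n + k))"
  proof (intro equalityI subsetI)
    fix x assume "x \<in> (\<Union>F\<in>Pow {..<n}. signature_cell M C F)"
    then show "x \<in> space M - (\<Union>k. C (n + k))"
      by (auto simp: signature_cell_def)
  next
    fix x assume x: "x \<in> space M - (\<Union>k. C (n + k))"
    have "x \<notin> C k" if "n \<le> k" for k
      using x le_Suc_ex[OF that] by auto
    then have "{k. x \<in> C k} \<in> Pow {..<n}" by (auto simp: not_le[symmetric])
    moreover have "x \<in> signature_cell M C {k. x \<in> C k}"
      using x by (auto simp: signature_cell_def)
    ultimately show "x \<in> (\<Union>F\<in>Pow {..<n}. signature_cell M C F)" by blast
  qed
  finally show ?thesis .
qed

text \<open>Cells whose signature contains \<open>k\<close> are disjoint subsets of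
  \<open>C k\<close>.\<close>

lemma sum_prob_signature_cell_le:
  assumes C: "\<And>k. C k \<in> sets M" and "finite \<F>"
  shows "(\<Sum>F\<in>{F\<in>\<F>. k \<in> F}. prob (signature_cell M C F)) \<le> prob (C k)"
proof -
  have "(\<Sum>F\<in>{F\<in>\<F>. k \<in> F}. prob (signature_cell M C F))
      = prob (\<Union>F\<in>{F\<in>\<F>. k \<in> F}. signature_cell M C F)"
    using assms by (intro finite_measure_finite_Union[symmetric] disjoint_family_signature_cell)
      (auto intro: sets_signature_cell)
  also have "\<dots> \<le> prob (C k)"
    using C by (intro finite_measure_mono) (auto simp: signature_cell_def)
  finally show ?thesis .
qed

text \<open>Gibbs' inequality against the weights \<open>\<Prod>k\<in>F. prob (C k)\<close>, whose total mass over all finite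
  \<open>F\<close> is \<open>\<Prod>k. (1 + prob (C k))\<close>.\<close>

lemma signature_entropy_Pow_le:
  assumes C: "\<And>k. C k \<in> sets M"
    and a: "(\<Sum>k<n. - (prob (C k) * ln (prob (C k)))) \<le> a"
    and b: "(\<Sum>k<n. prob (C k)) \<le> b"
  shows "(\<Sum>F\<in>Pow {..<n}. - (prob (signature_cell M C F) * ln (prob (signature_cell M C F))))
    \<le> a + exp b - prob (space M - (\<Union>k. C (n + k)))"
proof -
  let ?c = "\<lambda>k. prob (C k)" and ?p = "\<lambda>F. prob (signature_cell M C F)"
  let ?q = "\<lambda>F. \<Prod>k\<in>F. ?c k"
  have term_le: "- (?p F * ln (?p F)) \<le> (\<Sum>k\<in>F. ?p F * (- ln (?c k))) + ?q F - ?p F"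
    if F: "F \<in> Pow {..<n}" for F
  proof -
    have fin: "finite F" using F finite_subset by auto
    have le: "?p F \<le> ?c k" if "k \<in> F" for k
      using that C by (intro finite_measure_mono) (auto simp: signature_cell_def)
    \<comment> \<open>A vanishing factor forces the cell to be null, so \<open>?q F = 0\<close>
      implies \<open>?p F = 0\<close>, as Gibbs' inequality requires.\<close>
    have zero: "?p F = 0" if "?c k = 0" "k \<in> F" for k
      using le[OF that(2)] that(1) measure_nonneg[of M "signature_cell M C F"] by simp
    have "- (?p F * ln (?p F)) \<le> ?p F * (- ln (?q F)) + ?q F - ?p F"
      using fin zero by (intro entropy_term_le) (auto intro: prod_nonneg)
    moreover have "?p F * (- ln (?q F)) = (\<Sum>k\<in>F. ?p F * (- ln (?c k)))"
    proof (cases "?p F = 0")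
      case False
      then have "?c k > 0" if "k \<in> F" for k
        using zero that by (auto simp: zero_less_measure_iff)
      then have "ln (?q F) = (\<Sum>k\<in>F. ln (?c k))" using fin by (intro ln_prod) force+
      then show ?thesis by (simp add: sum_distrib_left sum_negf)
    qed simp
    ultimately show ?thesis by simp
  qed
  \<comment> \<open>Double counting: once the sums are swapped, \<open>- ln (?c k)\<close> is
    weighted by the mass of the cells whose signature contains \<open>k\<close>, which is at most
    \<open>?c k\<close>.\<close>
  have "(\<Sum>F\<in>Pow {..<n}. \<Sum>k\<in>F. ?p F * (- ln (?c k)))
      = (\<Sum>k<n. \<Sum>F\<in>{F\<in>Pow {..<n}. k \<in> F}. ?p F * (- ln (?c k)))"
  proof -
    have "(\<Sum>F\<in>Pow {..<n}. \<Sum>k\<in>F. ?p F * (- ln (?c k)))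
      = (\<Sum>F\<in>Pow {..<n}. \<Sum>k\<in>{k\<in>{..<n}. k \<in> F}. ?p F * (- ln (?c k)))"
      by (intro sum.cong) auto
    also have "\<dots> = (\<Sum>k<n. \<Sum>F\<in>{F\<in>Pow {..<n}. k \<in> F}. ?p F * (- ln (?c k)))"
      by (rule sum.swap_restrict) auto
    finally show ?thesis .
  qed
  also have "\<dots> \<le> (\<Sum>k<n. - (?c k * ln (?c k)))"
  proof (intro sum_mono)
    fix k
    have "(\<Sum>F\<in>{F\<in>Pow {..<n}. k \<in> F}. ?p F * (- ln (?c k)))
        = (\<Sum>F\<in>{F\<in>Pow {..<n}. k \<in> F}. ?p F) * (- ln (?c k))"
      by (simp only: sum_distrib_right)
    also have "\<dots> \<le> ?c k * (- ln (?c k))"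
    proof (cases "?c k = 0")
      case False
      then have "0 < ?c k" by (simp add: zero_less_measure_iff)
      then have "ln (?c k) \<le> 0" by simp
      then show ?thesis
        using C by (intro mult_right_mono sum_prob_signature_cell_le) auto
    qed simp
    finally show "(\<Sum>F\<in>{F\<in>Pow {..<n}. k \<in> F}. ?p F * (- ln (?c k))) \<le> - (?c k * ln (?c k))" by simp
  qed
  also note a
  finally have 1: "(\<Sum>F\<in>Pow {..<n}. \<Sum>k\<in>F. ?p F * (- ln (?c k))) \<le> a" .
  \<comment> \<open>Expanding the product of the factors \<open>?c k + 1\<close> gives one summand
    per subset; then \<open>1 + x \<le> exp x\<close> bounds each factor.\<close>
  have "(\<Sum>F\<in>Pow {..<n}. ?q F) = (\<Prod>k<n. ?c k + 1)"
    by (subst prod_add) auto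
  also have "\<dots> \<le> (\<Prod>k<n. exp (?c k))"
    by (intro prod_mono) (simp add: add.commute)
  also have "\<dots> = exp (\<Sum>k<n. ?c k)" by (simp add: exp_sum)
  also have "\<dots> \<le> exp b" using b by simp
  finally have 2: "(\<Sum>F\<in>Pow {..<n}. ?q F) \<le> exp b" .
  have "(\<Sum>F\<in>Pow {..<n}. - (?p F * ln (?p F)))
    \<le> (\<Sum>F\<in>Pow {..<n}. (\<Sum>k\<in>F. ?p F * (- ln (?c k))) + ?q F - ?p F)"
    by (intro sum_mono term_le)
  also have "\<dots> \<le> a + exp b - (\<Sum>F\<in>Pow {..<n}. ?p F)"
    unfolding sum_subtractf sum.distrib using 1 2 by simp
  finally show ?thesis using C by (simp add: sum_prob_signature_cell_Pow)
qed

lemma entropy_term_nonneg: "0 \<le> - (prob A * ln (prob A))"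
  by (cases "prob A = 0") (auto simp: mult_le_0_iff zero_less_measure_iff)

text \<open>By countable subadditivity the tail union has measure at most a tail of a convergent
  series.\<close>

lemma prob_Diff_tail_tendsto:
  assumes C: "\<And>k. C k \<in> sets M" and sm: "summable (\<lambda>k. prob (C k))"
  shows "(\<lambda>n. prob (space M - (\<Union>k. C (n + k)))) \<longlonglongrightarrow> 1"
proof -
  have tail: "(\<lambda>n. \<Sum>k. prob (C (k + n))) \<longlonglongrightarrow> 0"
    using sm by (rule suminf_exist_split2)
  have "prob (\<Union>k. C (n + k)) \<le> (\<Sum>k. prob (C (k + n)))" for n
    using finite_measure_subadditive_countably[of "\<lambda>k. C (n + k)"] C
      summable_ignore_initial_segment[OF sm, of n] by (auto simp: add.commute)
  then have "(\<lambda>n. prob (\<Union>k. C (n + k))) \<longlonglongrightarrow> 0"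
    by (intro tendsto_sandwich[OF _ _ tendsto_const tail]) auto
  then have "(\<lambda>n. 1 - prob (\<Union>k. C (n + k))) \<longlonglongrightarrow> 1 - 0"
    by (intro tendsto_diff tendsto_const)
  then show ?thesis
    using C by (subst prob_compl) auto
qed

text \<open>A finite family of finite signatures lies in \<open>Pow {..<n}\<close> for all large
  \<open>n\<close>, and the entropy terms are nonnegative, so the bound over
  \<open>Pow {..<n}\<close> applies. As \<open>n\<close> grows, the subtracted probability tends to
  1.\<close>

lemma signature_entropy_le:
  assumes C: "\<And>k. C k \<in> sets M"
    and a: "\<And>n. (\<Sum>k<n. - (prob (C k) * ln (prob (C k)))) \<le> a"
    and b: "\<And>n. (\<Sum>k<n. prob (C k)) \<le> b"
    and \<F>: "finite \<F>" "\<And>F. F \<in> \<F> \<Longrightarrow> finite F"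
  shows "(\<Sum>F\<in>\<F>. - (prob (signature_cell M C F) * ln (prob (signature_cell M C F))))
    \<le> a + exp b - 1"
proof -
  let ?\<eta> = "\<lambda>F. - (prob (signature_cell M C F) * ln (prob (signature_cell M C F)))"
  have sm: "summable (\<lambda>k. prob (C k))"
    by (intro summableI_nonneg_bounded[of _ b] b) auto
  have "finite (\<Union>\<F>)" using \<F> by auto
  then obtain m where m: "\<Union>\<F> \<subseteq> {..<m}" using finite_nat_bounded by blast
  have "(\<Sum>F\<in>\<F>. ?\<eta> F) \<le> a + exp b - prob (space M - (\<Union>k. C (n + k)))" if "m \<le> n" for n
  proof -
    have "(\<Sum>F\<in>\<F>. ?\<eta> F) \<le> (\<Sum>F\<in>Pow {..<n}. ?\<eta> F)"
      using m that by (intro sum_mono2 entropy_term_nonneg) fastforce+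
    also have "\<dots> \<le> a + exp b - prob (space M - (\<Union>k. C (n + k)))"
      using C a b by (intro signature_entropy_Pow_le)
    finally show ?thesis .
  qed
  then have "\<forall>\<^sub>F n in sequentially. (\<Sum>F\<in>\<F>. ?\<eta> F) \<le> a + exp b - prob (space M - (\<Union>k. C (n + k)))"
    using eventually_sequentially by blast
  moreover have "(\<lambda>n. a + exp b - prob (space M - (\<Union>k. C (n + k)))) \<longlonglongrightarrow> a + exp b - 1"
    by (intro tendsto_intros prob_Diff_tail_tendsto C sm)
  ultimately show ?thesis
    using tendsto_lowerbound trivial_limit_sequentially by blast
qed

end

text \<open>Reduces bounds on entropy to bounds on finite sums of reals.\<close>

lemma (in prob_space) shannon_entropy_eq_SUP:
  "shannon_entropy M \<alpha> = (SUP \<gamma>\<in>{\<gamma>. finite \<gamma> \<and> \<gamma> \<subseteq> \<alpha>}. ennreal (\<Sum>A\<in>\<gamma>. - (prob A * ln (prob A))))"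
  unfolding shannon_entropy_def
  by (subst nonneg_infsum_complete, rule zero_le,
      intro SUP_cong[OF refl] sum_ennreal entropy_term_nonneg)

text \<open>Writing the family as \<open>sets N\<close> makes the closure rules for
  \<open>sets\<close> applicable to it.\<close>

lemma sigma_subalgebra_as_measure:
  assumes "sigma_subalgebra M \<A>"
  obtains N where "sets N = \<A>" "space N = space M"
proof
  interpret sigma_algebra "space M" \<A> using assms by (simp add: sigma_subalgebra_def)
  show "sets (sigma (space M) \<A>) = \<A>" by (rule sets_measure_of_eq)
  show "space (sigma (space M) \<A>) = space M" by (rule space_measure_of_eq)
qed

text \<open>Completeness in almost-everywhere form: sets that agree almost everywhere have a null
  symmetric difference.\<close>

lemma complete_subalgebraD:
  assumes "complete_subalgebra M \<A>" "sigma_subalgebra M \<A>" "A \<in> \<A>" "B \<in> sets M"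
    and "AE x in M. x \<in> A \<longleftrightarrow> x \<in> B"
  shows "B \<in> \<A>"
proof -
  have A: "A \<in> sets M" using assms(2,3) by (auto simp: sigma_subalgebra_def)
  have "emeasure M ((A - B) \<union> (B - A)) = emeasure M {}"
    using A assms(4,5) by (intro emeasure_eq_AE) auto
  then show ?thesis using assms(1,3,4) by (simp add: complete_subalgebra_def)
qed

text \<open>Only finite signatures receive a cell of their own, which keeps the partition countable;
  the inserted set collects the points with infinite signature.\<close>

definition signature_partition :: "'a measure \<Rightarrow> (nat \<Rightarrow> 'a set) \<Rightarrow> 'a set set" where
  "signature_partition M C =
     insert (space M - (\<Union>F\<in>Collect finite. signature_cell M C F))
       (signature_cell M C ` {F. finite F \<and> signature_cell M C F \<noteq> {}})"

lemma countable_finite_signatures: "countable {F. finite F \<and> signature_cell M C F \<noteq> {}}"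
  by (rule countable_subset[OF _ countable_Collect_finite]) auto

lemma signature_partition_subset:
  assumes "sigma_subalgebra M \<A>" "range C \<subseteq> \<A>"
  shows "signature_partition M C \<subseteq> \<A>"
proof -
  obtain N where N: "sets N = \<A>" "space N = space M"
    using assms(1) by (rule sigma_subalgebra_as_measure)
  \<comment> \<open>\<open>signature_cell\<close> depends on its measure only through the space, so
    \<open>M\<close> and \<open>N\<close> give the same cells.\<close>
  have cell: "signature_cell M C F \<in> sets N" for F
    using sets_signature_cell[of C N F] assms(2) N by (auto simp: signature_cell_def)
  have "(\<Union>F\<in>Collect finite. signature_cell M C F) \<in> sets N"
    using cell by (intro sets.countable_UN' countable_Collect_finite) auto
  then have "space M - (\<Union>F\<in>Collect finite. signature_cell M C F) \<in> sets N"
    using N(2) by (metis sets.compl_sets)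
  then show ?thesis using cell N(1) by (auto simp: signature_partition_def)
qed

lemma countable_partition_signature_partition:
  assumes "\<And>k. C k \<in> sets M"
  shows "countable_partition M (signature_partition M C)"
  unfolding countable_partition_def
proof (intro conjI)
  show "countable (signature_partition M C)"
    unfolding signature_partition_def
    by (intro countable_insert countable_image countable_finite_signatures)
  have "sigma_subalgebra M (sets M)"
    by (simp add: sigma_subalgebra_def sets.sigma_algebra_axioms)
  then show "signature_partition M C \<subseteq> sets M"
    using assms by (intro signature_partition_subset) auto
  show "disjoint (signature_partition M C)"
    by (auto simp: disjoint_def signature_partition_def) (auto simp: signature_cell_def)
  show "\<Union> (signature_partition M C) = space M"
    by (auto simp: signature_partition_def) (auto simp: signature_cell_def)
qed

section \<open>Generation and entropy of the signature partition\<close>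

context prob_space
begin

lemma AE_finite_signature:
  assumes C: "\<And>k. C k \<in> sets M" and sm: "summable (\<lambda>k. prob (C k))"
  shows "AE x in M. x \<in> (\<Union>F\<in>Collect finite. signature_cell M C F)"
proof -
  have "AE x in M. \<forall>\<^sub>F k in sequentially. x \<in> space M - C k"
    using C sm by (intro borel_cantelli_AE1) (auto simp: emeasure_eq_measure)
  then show ?thesis
  proof (rule AE_mp, intro AE_I2 impI)
    fix x assume x: "x \<in> space M" and "\<forall>\<^sub>F k in sequentially. x \<in> space M - C k"
    then obtain n where n: "\<And>k. n \<le> k \<Longrightarrow> x \<notin> C k" by (auto simp: eventually_sequentially)
    have "{k. x \<in> C k} \<subseteq> {..<n}" using n by (auto simp: not_le[symmetric])
    then have "finite {k. x \<in> C k}" using finite_subset by blast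
    moreover have "x \<in> signature_cell M C {k. x \<in> C k}" using x by (simp add: signature_cell_def)
    ultimately show "x \<in> (\<Union>F\<in>Collect finite. signature_cell M C F)" by blast
  qed
qed

text \<open>Since almost every signature is finite, \<open>C k\<close> agrees almost everywhere with
  the countable union of the cells of finite signatures containing \<open>k\<close>. Completeness
  absorbs the null set.\<close>

lemma signature_partition_generates:
  assumes C: "\<And>k. C k \<in> sets M" and sm: "summable (\<lambda>k. prob (C k))"
    and \<A>: "sigma_subalgebra M \<A>" "complete_subalgebra M \<A>" "signature_partition M C \<subseteq> \<A>"
  shows "C k \<in> \<A>"
proof -
  obtain N where N: "sets N = \<A>" "space N = space M"
    using \<A>(1) by (rule sigma_subalgebra_as_measure)
  have cell: "signature_cell M C F \<in> sets N" if "finite F" for F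
    using \<A>(3) N that by (cases "signature_cell M C F = {}") (auto simp: signature_partition_def)
  have U: "(\<Union>F\<in>{F. finite F \<and> k \<in> F}. signature_cell M C F) \<in> \<A>"
    unfolding N(1)[symmetric] using cell
    by (intro sets.countable_UN' countable_subset[OF _ countable_Collect_finite]) auto
  show ?thesis
  proof (rule complete_subalgebraD[OF \<A>(2,1) U C])
    show "AE x in M. x \<in> (\<Union>F\<in>{F. finite F \<and> k \<in> F}. signature_cell M C F) \<longleftrightarrow> x \<in> C k"
      using AE_finite_signature[OF C sm]
      by (rule AE_mp) (auto intro!: AE_I2 simp: signature_cell_def)
  qed
qed

text \<open>The set of points with infinite signature is null and contributes nothing; the other
  cells are covered by the bound for finite families of signatures.\<close>

lemma shannon_entropy_signature_partition_le:
  assumes C: "\<And>k. C k \<in> sets M"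
    and a: "\<And>n. (\<Sum>k<n. - (prob (C k) * ln (prob (C k)))) \<le> a"
    and b: "\<And>n. (\<Sum>k<n. prob (C k)) \<le> b"
  shows "shannon_entropy M (signature_partition M C) \<le> ennreal (a + exp b - 1)"
  unfolding shannon_entropy_eq_SUP
proof (intro SUP_least ennreal_leI, clarify)
  let ?\<eta> = "\<lambda>A. - (prob A * ln (prob A))"
  let ?R = "space M - (\<Union>F\<in>Collect finite. signature_cell M C F)"
  fix \<gamma> assume \<gamma>: "finite \<gamma>" "\<gamma> \<subseteq> signature_partition M C"
  have sm: "summable (\<lambda>k. prob (C k))"
    by (intro summableI_nonneg_bounded[of _ b] b) auto
  have "emeasure M ?R = emeasure M {}"
  proof (rule emeasure_eq_AE)
    show "AE x in M. x \<in> ?R \<longleftrightarrow> x \<in> {}"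
      using AE_finite_signature[OF C sm] by (rule AE_mp) auto
    show "?R \<in> sets M"
      using countable_partition_signature_partition[of C M] C
      by (auto simp: countable_partition_def signature_partition_def)
  qed simp
  then have R: "?\<eta> ?R = 0" by (simp add: measure_def)
  define \<F> where "\<F> = {F. finite F \<and> signature_cell M C F \<noteq> {} \<and> signature_cell M C F \<in> \<gamma>}"
  \<comment> \<open>A nonempty cell determines its signature, so sums over cells can be reindexed by
    signatures.\<close>
  have inj: "inj_on (signature_cell M C) \<F>"
    unfolding inj_on_def \<F>_def signature_cell_def by blast
  have im: "signature_cell M C ` \<F> \<subseteq> \<gamma>" by (auto simp: \<F>_def)
  then have fin: "finite \<F>" using inj \<gamma>(1) finite_subset finite_image_iff by metis
  have "(\<Sum>A\<in>\<gamma>. ?\<eta> A) \<le> (\<Sum>A\<in>insert ?R (signature_cell M C ` \<F>). ?\<eta> A)"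
    using \<gamma>(2) fin
    by (intro sum_mono2 entropy_term_nonneg) (auto simp: signature_partition_def \<F>_def)
  also have "\<dots> = (\<Sum>A\<in>signature_cell M C ` \<F>. ?\<eta> A)"
    using fin R by (cases "?R \<in> signature_cell M C ` \<F>") (auto simp: insert_absorb)
  also have "\<dots> = (\<Sum>F\<in>\<F>. ?\<eta> (signature_cell M C F))"
    by (simp add: sum.reindex[OF inj])
  also have "\<dots> \<le> a + exp b - 1"
    using C a b fin by (intro signature_entropy_le) (auto simp: \<F>_def)
  finally show "(\<Sum>A\<in>\<gamma>. ?\<eta> A) \<le> a + exp b - 1" .
qed

end

subsection \<open>Generated subalgebras\<close>

text \<open>All defining conditions are closure properties and pass to intersections; nonemptiness
  of \<open>\<B>\<close> keeps the intersection inside \<open>sets M\<close>.\<close>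

lemma complete_invariant_subalgebras_Inter:
  assumes "\<B> \<subseteq> complete_invariant_subalgebras G M T" "\<B> \<noteq> {}"
  shows "\<Inter>\<B> \<in> complete_invariant_subalgebras G M T"
proof -
  have *: "sigma_algebra (space M) \<A>" "\<A> \<subseteq> sets M" "complete_subalgebra M \<A>"
    "invariant_subalgebra G T \<A>" if "\<A> \<in> \<B>" for \<A>
    using that assms(1) by (auto simp: complete_invariant_subalgebras_def sigma_subalgebra_def)
  have "sigma_algebra (space M) (\<Inter>\<B>)"
    unfolding sigma_algebra_iff2
  proof (intro conjI ballI allI impI)
    show "\<Inter>\<B> \<subseteq> Pow (space M)" using *(2) assms(2) sets.space_closed by blast
    show "{} \<in> \<Inter>\<B>" using *(1) by (auto simp: sigma_algebra_iff2)
    show "space M - s \<in> \<Inter>\<B>" if "s \<in> \<Inter>\<B>" for s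
      using *(1) that by (auto simp: sigma_algebra_iff2)
    show "(\<Union>i. A i) \<in> \<Inter>\<B>" if "range A \<subseteq> \<Inter>\<B>" for A :: "nat \<Rightarrow> _"
    proof
      fix \<A> assume "\<A> \<in> \<B>"
      then have "range A \<subseteq> \<A>" "sigma_algebra (space M) \<A>" using that *(1) by auto
      then show "(\<Union>i. A i) \<in> \<A>" by (simp add: sigma_algebra_iff2)
    qed
  qed
  moreover have "\<Inter>\<B> \<subseteq> sets M" using *(2) assms(2) by blast
  moreover have "complete_subalgebra M (\<Inter>\<B>)"
    using *(3) unfolding complete_subalgebra_def by blast
  moreover have "invariant_subalgebra G T (\<Inter>\<B>)"
    using *(4) unfolding invariant_subalgebra_def by blast
  ultimately show ?thesis
    by (simp add: complete_invariant_subalgebras_def sigma_subalgebra_def)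
qed

text \<open>The image of a set under \<open>T g\<close> is its preimage under the action of the
  inverse of \<open>g\<close>, hence measurable. Thus every \<open>S \<subseteq> sets M\<close> lies
  in some complete invariant subalgebra.\<close>

lemma sets_in_complete_invariant_subalgebras:
  assumes "dynamical_system G M T"
  shows "sets M \<in> complete_invariant_subalgebras G M T"
proof -
  interpret group_action G "space M" T using assms by (simp add: dynamical_system_def)
  interpret group_hom G "BijGroup (space M)" T by (rule group_hom)
  have "T g ` A \<in> sets M" if A: "A \<in> sets M" and g: "g \<in> carrier G" for A g
  proof -
    have A': "A \<subseteq> space M" using A sets.sets_into_space by blast
    have 1: "T (inv\<^bsub>G\<^esub> g) (T g x) = x" if "x \<in> space M" for x
      using orbit_sym_aux[OF g that refl] .
    have 2: "T g (T (inv\<^bsub>G\<^esub> g) x) = x" if "x \<in> space M" for x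
      using orbit_sym_aux[OF G.inv_closed[OF g] that refl] g by simp
    have "T g ` A = T (inv\<^bsub>G\<^esub> g) -` A \<inter> space M"
    proof (intro equalityI subsetI)
      fix y assume "y \<in> T g ` A"
      then show "y \<in> T (inv\<^bsub>G\<^esub> g) -` A \<inter> space M"
        using 1 A' g element_image[OF g _ refl] by auto
    next
      fix y assume "y \<in> T (inv\<^bsub>G\<^esub> g) -` A \<inter> space M"
      then show "y \<in> T g ` A" using 2 by (metis IntD1 IntD2 image_eqI vimageD)
    qed
    also have "\<dots> \<in> sets M"
      using assms g A G.inv_closed[OF g]
      by (metis measurable_sets dynamical_system_def measure_preserving_map_def)
    finally show ?thesis .
  qed
  then show ?thesis
    by (auto simp: complete_invariant_subalgebras_def sigma_subalgebra_def
        complete_subalgebra_def invariant_subalgebra_def sets.sigma_algebra_axioms)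
qed

text \<open>Meaningful for \<open>S \<subseteq> sets M\<close>; otherwise the intersected family is
  empty.\<close>

definition generated_subalgebra ::
    "('g, 'm) monoid_scheme \<Rightarrow> 'a measure \<Rightarrow> ('g \<Rightarrow> 'a \<Rightarrow> 'a) \<Rightarrow> 'a set set \<Rightarrow> 'a set set" where
  "generated_subalgebra G M T S = \<Inter>{\<B> \<in> complete_invariant_subalgebras G M T. S \<subseteq> \<B>}"

lemma generates_generated_subalgebra:
  assumes "dynamical_system G M T" "S \<subseteq> sets M"
  shows "generates G M T S (generated_subalgebra G M T S)"
proof -
  have "generated_subalgebra G M T S \<in> complete_invariant_subalgebras G M T"
    unfolding generated_subalgebra_def
    using sets_in_complete_invariant_subalgebras[OF assms(1)] assms(2)
    by (intro complete_invariant_subalgebras_Inter) auto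
  then show ?thesis by (auto simp: generates_def generated_subalgebra_def)
qed

subsection \<open>Countable joins\<close>

text \<open>Lists a possibly finite family as a sequence padded with \<open>{}\<close>. The last
  property says that no member is counted twice in partial sums of a function vanishing at
  \<open>{}\<close>.\<close>

lemma countable_sets_as_sequence:
  fixes \<C> :: "'a set set"
  assumes "countable \<C>"
  obtains C :: "nat \<Rightarrow> 'a set" where "range C \<subseteq> insert {} \<C>" "\<C> \<subseteq> range C"
    "\<forall>(f :: 'a set \<Rightarrow> real) n. f {} = 0 \<longrightarrow>
      (\<exists>K. finite K \<and> K \<subseteq> \<C> \<and> (\<Sum>k<n. f (C k)) = (\<Sum>A\<in>K. f A))"
proof -
  define I where "I = to_nat_on \<C> ` \<C>"
  \<comment> \<open>Outside \<open>I\<close>, \<open>from_nat_into\<close> would return a fixed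
    member of a nonempty \<open>\<C>\<close> again and again.\<close>
  define C where "C k = (if k \<in> I then from_nat_into \<C> k else {})" for k
  have C: "C (to_nat_on \<C> A) = A" if "A \<in> \<C>" for A using that assms by (simp add: C_def I_def)
  have range: "range C \<subseteq> insert {} \<C>"
    using C by (auto simp: I_def C_def)
  have surj: "\<C> \<subseteq> range C"
  proof
    fix A assume "A \<in> \<C>"
    from C[OF this] show "A \<in> range C" by (intro range_eqI) (rule sym)
  qed
  have "\<exists>K. finite K \<and> K \<subseteq> \<C> \<and> (\<Sum>k<n. f (C k)) = (\<Sum>A\<in>K. f A)"
    if f: "f {} = 0" for f :: "'a set \<Rightarrow> real" and n
  proof -
    have "inj_on C ({..<n} \<inter> I)"
      using C by (auto simp: inj_on_def I_def)
    then have "(\<Sum>A\<in>C ` ({..<n} \<inter> I). f A) = (\<Sum>k\<in>{..<n} \<inter> I. f (C k))"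
      by (simp add: sum.reindex)
    also have "\<dots> = (\<Sum>k<n. f (C k))"
      using f by (intro sum.mono_neutral_left) (auto simp: C_def)
    finally have "(\<Sum>k<n. f (C k)) = (\<Sum>A\<in>C ` ({..<n} \<inter> I). f A)" by simp
    moreover have "C ` ({..<n} \<inter> I) \<subseteq> \<C>" using C by (auto simp: I_def)
    ultimately show ?thesis by (intro exI[of _ "C ` ({..<n} \<inter> I)"]) simp
  qed
  with range surj show thesis by (intro that) blast+
qed

section \<open>Small cells of a partition\<close>

context prob_space
begin

lemma sum_entropy_term_le:
  assumes "shannon_entropy M \<alpha> \<le> ennreal r" "0 \<le> r" "finite \<gamma>" "\<gamma> \<subseteq> \<alpha>"
  shows "(\<Sum>A\<in>\<gamma>. - (prob A * ln (prob A))) \<le> r"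
proof -
  have "ennreal (\<Sum>A\<in>\<gamma>. - (prob A * ln (prob A))) \<le> shannon_entropy M \<alpha>"
    unfolding shannon_entropy_eq_SUP using assms(3,4) by (intro SUP_upper) auto
  then have "ennreal (\<Sum>A\<in>\<gamma>. - (prob A * ln (prob A))) \<le> ennreal r" using assms(1) by simp
  then show ?thesis using assms(2) by (simp only: ennreal_le_iff)
qed

text \<open>For \<open>p \<le> 1/2\<close> one has \<open>- ln p \<ge> ln 2 \<ge> 1/2\<close>. Thus
  small entropy forces a small sum of measures of the small cells, which is what Borel-Cantelli
  needs.\<close>

lemma prob_le_entropy_term:
  assumes "prob A \<le> 1 / 2"
  shows "prob A \<le> 2 * - (prob A * ln (prob A))"
proof (cases "prob A = 0")
  case False
  then have pos: "0 < prob A" by (simp add: zero_less_measure_iff)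
  then have "ln (prob A) \<le> ln (1 / 2)" using assms by simp
  also have "\<dots> \<le> - (1 / 2)" using ln2_ge_two_thirds by (simp add: ln_div)
  finally have "prob A * 1 \<le> prob A * (2 * - ln (prob A))"
    using pos by (intro mult_left_mono) auto
  then show ?thesis by simp
qed simp

text \<open>At most one cell of a partition has measure above \<open>1/2\<close>, and it is the complement of the
  others.\<close>

lemma partition_generated_by_small_cells:
  assumes \<alpha>: "countable_partition M \<alpha>" and \<A>: "sigma_subalgebra M \<A>"
    and small: "{A \<in> \<alpha>. prob A \<le> 1 / 2} \<subseteq> \<A>"
  shows "\<alpha> \<subseteq> \<A>"
proof
  fix A assume A: "A \<in> \<alpha>"
  obtain N where N: "sets N = \<A>" "space N = space M"
    using \<A> by (rule sigma_subalgebra_as_measure)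
  show "A \<in> \<A>"
  proof (cases "prob A \<le> 1 / 2")
    case False
    have "prob B \<le> 1 / 2" if B: "B \<in> \<alpha>" "B \<noteq> A" for B
    proof -
      have "prob A + prob B = prob (A \<union> B)"
        using \<alpha> A B
        by (intro finite_measure_Union[symmetric]) (auto simp: countable_partition_def disjoint_def)
      then show ?thesis using False prob_le_1[of "A \<union> B"] by linarith
    qed
    then have sub: "\<alpha> - {A} \<subseteq> \<A>" using small by auto
    have "\<Union>(\<alpha> - {A}) \<in> sets N"
      using \<alpha> sub N by (intro sets.countable_Union) (auto simp: countable_partition_def)
    then have "space N - \<Union>(\<alpha> - {A}) \<in> sets N" by (rule sets.compl_sets)
    moreover have "space N - \<Union>(\<alpha> - {A}) = A"
    proof -
      have "A \<inter> B = {}" if "B \<in> \<alpha>" "B \<noteq> A" for B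
        using \<alpha> A that by (auto simp: countable_partition_def disjoint_def)
      moreover have "\<Union>\<alpha> = space N" using \<alpha> N by (simp add: countable_partition_def)
      ultimately show ?thesis using A by blast
    qed
    ultimately show ?thesis using N by simp
  qed (use A small in auto)
qed

end

section \<open>Joins of zero-entropy subalgebras\<close>

lemma dynamical_system_prob_space:
  assumes "dynamical_system G M T"
  shows "prob_space M"
proof -
  obtain N where "prob_space N" "M = completion N"
    using assms by (auto simp: dynamical_system_def standard_probability_space_def)
  then show ?thesis by (auto intro: prob_space.prob_space_completion)
qed

lemma small_generating_partition:
  assumes "\<A> \<in> zero_entropy_subalgebras G M T" "0 < e"
  obtains \<alpha> where "countable_partition M \<alpha>" "generates G M T \<alpha> \<A>" "shannon_entropy M \<alpha> \<le> ennreal e"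
proof -
  have "rokhlin_entropy G M T \<A> < ennreal e"
    using assms by (simp add: zero_entropy_subalgebras_def)
  then obtain \<alpha> where "countable_partition M \<alpha>" "generates G M T \<alpha> \<A>"
      "shannon_entropy M \<alpha> < ennreal e"
    unfolding rokhlin_entropy_def Inf_less_iff by auto
  then show ?thesis using that less_imp_le by metis
qed

text \<open>The partition is the signature partition of the small cells of generating partitions of
  the \<open>\<A> n\<close>. The entropy terms of these cells sum to at most \<open>e\<close>, and
  therefore their measures to at most \<open>2 * e\<close>.\<close>

lemma countable_join_generating_partition:
  fixes \<A> :: "nat \<Rightarrow> 'a set set"
  assumes ds: "dynamical_system G M T"
    and \<A>: "\<And>n. \<A> n \<in> zero_entropy_subalgebras G M T" and e: "0 < e"
  obtains \<beta> where "countable_partition M \<beta>"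
    "generates G M T \<beta> (generated_subalgebra G M T (\<Union>n. \<A> n))"
    "shannon_entropy M \<beta> \<le> ennreal (e + exp (2 * e) - 1)"
proof -
  interpret prob_space M using ds by (rule dynamical_system_prob_space)
  let ?P = "generated_subalgebra G M T (\<Union>n. \<A> n)"
  let ?\<eta> = "\<lambda>A. - (prob A * ln (prob A))"
  \<comment> \<open>The entropy allowances \<open>e / 2 ^ (n + 1)\<close> sum to
    \<open>e\<close>.\<close>
  have "\<exists>\<alpha>. countable_partition M \<alpha> \<and> generates G M T \<alpha> (\<A> n) \<and>
      shannon_entropy M \<alpha> \<le> ennreal (e * (1 / 2) ^ Suc n)" for n
  proof -
    have "0 < e * (1 / 2) ^ Suc n" using e by simp
    from small_generating_partition[OF \<A>[of n] this] show ?thesis by blast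
  qed
  then obtain \<alpha> where \<alpha>: "\<And>n. countable_partition M (\<alpha> n)" "\<And>n. generates G M T (\<alpha> n) (\<A> n)"
      "\<And>n. shannon_entropy M (\<alpha> n) \<le> ennreal (e * (1 / 2) ^ Suc n)"
    by metis
  have \<A>sub: "(\<Union>n. \<A> n) \<subseteq> sets M"
    using \<A> by (auto simp: zero_entropy_subalgebras_def complete_invariant_subalgebras_def
        sigma_subalgebra_def)
  have P: "generates G M T (\<Union>n. \<A> n) ?P"
    using ds \<A>sub by (rule generates_generated_subalgebra)
  define \<C> where "\<C> = (\<Union>n. {A \<in> \<alpha> n. prob A \<le> 1 / 2})"
  have "countable {A \<in> \<alpha> n. prob A \<le> 1 / 2}" for n
    using \<alpha>(1)[of n] by (intro countable_Collect) (simp add: countable_partition_def)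
  then have "countable \<C>" by (simp add: \<C>_def)
  then obtain C :: "nat \<Rightarrow> 'a set" where C: "range C \<subseteq> insert {} \<C>" "\<C> \<subseteq> range C"
    "\<forall>(f :: 'a set \<Rightarrow> real) n. f {} = 0 \<longrightarrow>
      (\<exists>K. finite K \<and> K \<subseteq> \<C> \<and> (\<Sum>k<n. f (C k)) = (\<Sum>A\<in>K. f A))"
    by (rule countable_sets_as_sequence)
  have \<C>P: "\<C> \<subseteq> ?P"
  proof -
    have "\<alpha> n \<subseteq> \<A> n" for n using \<alpha>(2) by (simp add: generates_def)
    moreover have "\<A> n \<subseteq> ?P" for n using P by (auto simp: generates_def)
    ultimately show ?thesis unfolding \<C>_def by blast
  qed
  have Psub: "sigma_subalgebra M ?P"
    using P by (simp add: generates_def complete_invariant_subalgebras_def)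
  then have CP: "range C \<subseteq> ?P"
    using C(1) \<C>P by (auto simp: sigma_subalgebra_def sigma_algebra_iff2)
  then have Csets: "C k \<in> sets M" for k using Psub by (auto simp: sigma_subalgebra_def)
  have sum_\<eta>: "(\<Sum>A\<in>K. ?\<eta> A) \<le> e" if K: "finite K" "K \<subseteq> \<C>" for K
  proof -
    \<comment> \<open>A cell may occur in several partitions; \<open>i\<close> assigns it to one of
      them, so that grouping by \<open>i\<close> counts it once.\<close>
    have "\<forall>A\<in>K. \<exists>n. A \<in> \<alpha> n" using K(2) by (auto simp: \<C>_def)
    then obtain i where i: "\<And>A. A \<in> K \<Longrightarrow> A \<in> \<alpha> (i A)" by metis
    obtain m where m: "i ` K \<subseteq> {..<m}" using K(1) finite_nat_bounded by blast
    have "(\<Sum>A\<in>K. ?\<eta> A) = (\<Sum>n<m. \<Sum>A\<in>{A\<in>K. i A = n}. ?\<eta> A)"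
      using K(1) m by (intro sum.group[symmetric]) auto
    also have "\<dots> \<le> (\<Sum>n<m. e * (1 / 2) ^ Suc n)"
      using K(1) i e by (intro sum_mono sum_entropy_term_le[OF \<alpha>(3)]) auto
    also have "\<dots> = e * (\<Sum>n<m. (1 / 2) ^ Suc n)" by (simp only: sum_distrib_left)
    also have "\<dots> \<le> e * 1"
      using e sum_le_suminf[OF sums_summable[OF power_half_series], of "{..<m}"]
        sums_unique[OF power_half_series]
      by (intro mult_left_mono) auto
    finally show ?thesis by simp
  qed
  have a: "(\<Sum>k<n. ?\<eta> (C k)) \<le> e" for n
    using C(3)[rule_format, of ?\<eta> n] sum_\<eta> by auto
  have b: "(\<Sum>k<n. prob (C k)) \<le> 2 * e" for n
  proof -
    have small: "prob (C k) \<le> 1 / 2" for k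
    proof -
      have "C k \<in> insert {} \<C>" using C(1) by blast
      then show ?thesis by (auto simp: \<C>_def)
    qed
    have "(\<Sum>k<n. prob (C k)) \<le> (\<Sum>k<n. 2 * ?\<eta> (C k))"
      by (intro sum_mono prob_le_entropy_term small)
    also have "\<dots> = 2 * (\<Sum>k<n. ?\<eta> (C k))" by (simp only: sum_distrib_left)
    finally show ?thesis using a[of n] by linarith
  qed
  have sm: "summable (\<lambda>k. prob (C k))"
    by (intro summableI_nonneg_bounded[of _ "2 * e"] b) auto
  let ?\<beta> = "signature_partition M C"
  \<comment> \<open>From the signature partition, \<open>\<B>\<close> recovers in turn the sets
    \<open>C k\<close>, the small cells, the partitions \<open>\<alpha> n\<close>, the subalgebras
    \<open>\<A> n\<close> and so their join.\<close>
  have "?P \<subseteq> \<B>" if \<B>: "\<B> \<in> complete_invariant_subalgebras G M T" "?\<beta> \<subseteq> \<B>" for \<B>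
  proof -
    have \<B>': "sigma_subalgebra M \<B>" "complete_subalgebra M \<B>"
      using \<B>(1) by (auto simp: complete_invariant_subalgebras_def)
    have "range C \<subseteq> \<B>"
      using signature_partition_generates[OF Csets sm \<B>' \<B>(2)] by blast
    then have "\<C> \<subseteq> \<B>" using C(2) by (rule order_trans[rotated])
    then have "{A \<in> \<alpha> n. prob A \<le> 1 / 2} \<subseteq> \<B>" for n by (auto simp: \<C>_def)
    then have "\<alpha> n \<subseteq> \<B>" for n
      by (intro partition_generated_by_small_cells[OF \<alpha>(1) \<B>'(1)])
    then have "\<A> n \<subseteq> \<B>" for n using \<alpha>(2)[of n] \<B>(1) by (simp add: generates_def)
    then have "(\<Union>n. \<A> n) \<subseteq> \<B>" by blast
    then show ?thesis using P \<B>(1) by (simp add: generates_def)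
  qed
  then have "generates G M T ?\<beta> ?P"
    using P signature_partition_subset[OF Psub CP] by (simp add: generates_def)
  moreover have "countable_partition M ?\<beta>"
    using Csets by (rule countable_partition_signature_partition)
  moreover have "shannon_entropy M ?\<beta> \<le> ennreal (e + exp (2 * e) - 1)"
    using Csets a b by (rule shannon_entropy_signature_partition_le)
  ultimately show thesis by (intro that)
qed

text \<open>The bound \<open>e + exp (2 * e) - 1\<close> tends to 0 as \<open>e\<close> decreases to
  0.\<close>

lemma countable_join_zero_entropy:
  fixes \<A> :: "nat \<Rightarrow> 'a set set"
  assumes ds: "dynamical_system G M T" and \<A>: "\<And>n. \<A> n \<in> zero_entropy_subalgebras G M T"
  shows "generated_subalgebra G M T (\<Union>n. \<A> n) \<in> zero_entropy_subalgebras G M T"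
proof -
  let ?P = "generated_subalgebra G M T (\<Union>n. \<A> n)"
  have le: "rokhlin_entropy G M T ?P \<le> ennreal (e + exp (2 * e) - 1)" if e: "0 < e" for e
  proof -
    obtain \<beta> where \<beta>: "countable_partition M \<beta>" "generates G M T \<beta> ?P"
      "shannon_entropy M \<beta> \<le> ennreal (e + exp (2 * e) - 1)"
      by (rule countable_join_generating_partition[OF assms e])
    have "rokhlin_entropy G M T ?P \<le> shannon_entropy M \<beta>"
      unfolding rokhlin_entropy_def using \<beta>(1,2) by (intro Inf_lower) (auto simp: generates_def)
    then show ?thesis using \<beta>(3) by (rule order_trans)
  qed
  have "((\<lambda>e::real. e + exp (2 * e) - 1) \<longlongrightarrow> 0 + exp (2 * 0) - 1) (at_right 0)"
    by (intro tendsto_intros)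
  then have "((\<lambda>e. ennreal (e + exp (2 * e) - 1)) \<longlongrightarrow> ennreal 0) (at_right 0)"
    by (intro tendsto_ennrealI) simp
  then have "rokhlin_entropy G M T ?P \<le> ennreal 0"
  proof (rule tendsto_lowerbound)
    show "\<forall>\<^sub>F e in at_right 0. rokhlin_entropy G M T ?P \<le> ennreal (e + exp (2 * e) - 1)"
      using le by (intro eventually_at_rightI[of 0 1]) auto
  qed simp
  moreover have "?P \<in> complete_invariant_subalgebras G M T"
  proof -
    have "(\<Union>n. \<A> n) \<subseteq> sets M"
      using \<A> by (auto simp: zero_entropy_subalgebras_def complete_invariant_subalgebras_def
          sigma_subalgebra_def)
    then show ?thesis
      using generates_generated_subalgebra[OF ds] by (simp add: generates_def)
  qed
  ultimately show ?thesis by (simp add: zero_entropy_subalgebras_def)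
qed

text \<open>The one-cell partition has entropy \<open>- (1 * ln 1) = 0\<close>.\<close>

lemma zero_entropy_subalgebras_nonempty:
  assumes ds: "dynamical_system G M T"
  shows "generated_subalgebra G M T {space M} \<in> zero_entropy_subalgebras G M T"
proof -
  let ?P = "generated_subalgebra G M T {space M}"
  interpret prob_space M using ds by (rule dynamical_system_prob_space)
  have gen: "generates G M T {space M} ?P"
    using ds by (rule generates_generated_subalgebra) auto
  have "rokhlin_entropy G M T ?P \<le> shannon_entropy M {space M}"
    unfolding rokhlin_entropy_def using gen
    by (intro Inf_lower) (auto simp: generates_def countable_partition_def disjoint_def)
  also have "\<dots> = 0" by (simp add: shannon_entropy_def prob_space)
  finally show ?thesis using gen by (simp add: zero_entropy_subalgebras_def generates_def)
qed

subsection \<open>Separability and the greatest element\<close>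

text \<open>Says that \<open>A\<close> is in the closure of \<open>\<D>\<close> for the pseudometric
  given by the measure of the symmetric difference.\<close>

definition approximates :: "'a measure \<Rightarrow> 'a set set \<Rightarrow> 'a set \<Rightarrow> bool" where
  "approximates M \<D> A \<longleftrightarrow> (\<forall>e>0. \<exists>D\<in>\<D>. measure M ((A - D) \<union> (D - A)) < e)"

text \<open>Complements and binary unions are adjoined in countably many stages. Stages increase, so
  any two members lie in a common stage, and each stage is countable.\<close>

lemma countable_algebra_superset:
  assumes "countable \<B>"
  obtains \<D> where "countable \<D>" "\<B> \<subseteq> \<D>" "{} \<in> \<D>"
    "\<forall>A\<in>\<D>. \<Omega> - A \<in> \<D>" "\<forall>A\<in>\<D>. \<forall>B\<in>\<D>. A \<union> B \<in> \<D>"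
    "\<D> \<subseteq> sigma_sets \<Omega> \<B>"
proof
  define step where "step \<D> = \<D> \<union> (\<lambda>A. \<Omega> - A) ` \<D> \<union> (\<lambda>(A, B). A \<union> B) ` (\<D> \<times> \<D>)"
    for \<D> :: "'a set set"
  define E where "E n = (step ^^ n) (insert {} \<B>)" for n
  have E_0: "E 0 = insert {} \<B>" and E_Suc: "E (Suc n) = step (E n)" for n
    by (simp_all add: E_def)
  have mono: "E m \<subseteq> E n" if "m \<le> n" for m n
    using that by (rule lift_Suc_mono_le[rotated]) (auto simp: E_Suc step_def)
  have "countable (E n)" for n
    by (induction n) (use assms in \<open>auto simp: E_0 E_Suc step_def\<close>)
  then show "countable (\<Union>n. E n)" by simp
  show "\<B> \<subseteq> (\<Union>n. E n)" "{} \<in> (\<Union>n. E n)" using E_0 by blast+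
  show "\<forall>A\<in>(\<Union>n. E n). \<Omega> - A \<in> (\<Union>n. E n)"
  proof
    fix A assume A: "A \<in> (\<Union>n. E n)"
    obtain n where "A \<in> E n" using A by auto
    then have "\<Omega> - A \<in> E (Suc n)" by (auto simp: E_Suc step_def)
    then show "\<Omega> - A \<in> (\<Union>n. E n)" by blast
  qed
  show "\<forall>A\<in>(\<Union>n. E n). \<forall>B\<in>(\<Union>n. E n). A \<union> B \<in> (\<Union>n. E n)"
  proof (intro ballI)
    fix A B assume AB: "A \<in> (\<Union>n. E n)" "B \<in> (\<Union>n. E n)"
    obtain m n where "A \<in> E m" "B \<in> E n" using AB by auto
    then have "A \<in> E (max m n)" "B \<in> E (max m n)"
      using mono[of m "max m n"] mono[of n "max m n"] by auto
    then have "A \<union> B \<in> E (Suc (max m n))" by (auto simp: E_Suc step_def)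
    then show "A \<union> B \<in> (\<Union>n. E n)" by blast
  qed
  have "E n \<subseteq> sigma_sets \<Omega> \<B>" for n
    by (induction n)
      (auto simp: E_0 E_Suc step_def intro: sigma_sets.intros sigma_sets_Un)
  then show "(\<Union>n. E n) \<subseteq> sigma_sets \<Omega> \<B>" by blast
qed

section \<open>Approximation in measure\<close>

context finite_measure
begin

text \<open>Finitely many \<open>A i\<close> exhaust the union up to \<open>e / 2\<close>, and the
  errors in approximating them add up to at most another \<open>e / 2\<close>.\<close>

lemma approximates_Union:
  fixes A :: "nat \<Rightarrow> 'a set"
  assumes A: "\<And>i. A i \<in> sets M" and \<D>: "\<D> \<subseteq> sets M" "{} \<in> \<D>"
    "\<And>A B. A \<in> \<D> \<Longrightarrow> B \<in> \<D> \<Longrightarrow> A \<union> B \<in> \<D>"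
    and approx: "\<And>i. approximates M \<D> (A i)"
  shows "approximates M \<D> (\<Union>i. A i)"
  unfolding approximates_def
proof (intro allI impI)
  fix e :: real assume e: "0 < e"
  let ?U = "\<lambda>n. \<Union>i<n. A i"
  have "(\<lambda>n. measure M (?U n)) \<longlonglongrightarrow> measure M (\<Union>n. ?U n)"
    using A by (intro finite_Lim_measure_incseq) (auto simp: incseq_def intro: less_le_trans)
  also have "(\<Union>n. ?U n) = (\<Union>i. A i)" by blast
  finally have "\<forall>\<^sub>F n in sequentially. measure M (\<Union>i. A i) - e / 2 < measure M (?U n)"
    using e by (intro order_tendstoD) auto
  then obtain n where n: "measure M (\<Union>i. A i) - e / 2 < measure M (?U n)"
    by (auto simp: eventually_sequentially)
  \<comment> \<open>Dividing by \<open>Suc n\<close> avoids a zero denominator when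
    \<open>n = 0\<close>.\<close>
  have "\<exists>D\<in>\<D>. measure M ((A i - D) \<union> (D - A i)) < e / (2 * Suc n)" for i
    using approx[of i] e by (simp add: approximates_def)
  then obtain D where D: "\<And>i. D i \<in> \<D>"
    "\<And>i. measure M ((A i - D i) \<union> (D i - A i)) < e / (2 * Suc n)"
    by metis
  have D_sets: "D i \<in> sets M" for i using D(1) \<D>(1) by blast
  have "(\<Union>i<k. D i) \<in> \<D>" for k
    by (induction k) (auto simp: lessThan_Suc \<D> D(1))
  moreover have "measure M (((\<Union>i. A i) - (\<Union>i<n. D i)) \<union> ((\<Union>i<n. D i) - (\<Union>i. A i))) < e"
  proof -
    let ?S = "\<lambda>i. (A i - D i) \<union> (D i - A i)"
    have "measure M (((\<Union>i. A i) - (\<Union>i<n. D i)) \<union> ((\<Union>i<n. D i) - (\<Union>i. A i)))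
        \<le> measure M (((\<Union>i. A i) - ?U n) \<union> (\<Union>i<n. ?S i))"
      using A D_sets by (intro finite_measure_mono) (blast, auto)
    also have "\<dots> \<le> measure M ((\<Union>i. A i) - ?U n) + measure M (\<Union>i<n. ?S i)"
      using A D_sets by (intro measure_Un_le) auto
    also have "measure M ((\<Union>i. A i) - ?U n) = measure M (\<Union>i. A i) - measure M (?U n)"
      using A by (intro finite_measure_Diff) auto
    also have "measure M (\<Union>i<n. ?S i) \<le> (\<Sum>i<n. measure M (?S i))"
      using A D_sets by (intro finite_measure_subadditive_finite) auto
    also have "\<dots> \<le> (\<Sum>i<n. e / (2 * Suc n))"
      using D(2) by (intro sum_mono less_imp_le)
    also have "\<dots> \<le> e / 2" using e by (simp add: field_simps)
    finally show ?thesis using n by simp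
  qed
  ultimately show "\<exists>D\<in>\<D>. measure M (((\<Union>i. A i) - D) \<union> (D - (\<Union>i. A i))) < e" by blast
qed

text \<open>The approximating family is a countable algebra containing the generators. The sets it
  approximates are closed under complements and countable unions, so induction over
  \<open>sigma_sets\<close> reaches every measurable set.\<close>

lemma countable_approximating_family:
  assumes "countable \<B>" "\<B> \<subseteq> Pow (space M)" "sets M = sigma_sets (space M) \<B>"
  obtains \<D> where "countable \<D>" "\<D> \<subseteq> sets M" "\<forall>A\<in>sets M. approximates M \<D> A"
proof -
  obtain \<D> where \<D>: "countable \<D>" "\<B> \<subseteq> \<D>" "{} \<in> \<D>"
    "\<forall>A\<in>\<D>. space M - A \<in> \<D>" "\<forall>A\<in>\<D>. \<forall>B\<in>\<D>. A \<union> B \<in> \<D>"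
    "\<D> \<subseteq> sigma_sets (space M) \<B>"
    by (rule countable_algebra_superset[OF assms(1), where \<Omega> = "space M"])
  have self: "approximates M \<D> A" if "A \<in> \<D>" for A
    using that by (auto simp: approximates_def intro!: bexI[of _ A])
  have "approximates M \<D> A" if "A \<in> sigma_sets (space M) \<B>" for A
    using that
  proof induction
    case (Basic A)
    then show ?case using \<D>(2) self by blast
  next
    case Empty
    then show ?case using \<D>(3) self by blast
  next
    case (Compl A)
    have A: "A \<subseteq> space M"
      using Compl.hyps assms(3) sets.sets_into_space by blast
    show ?case
      unfolding approximates_def
    proof (intro allI impI)
      fix e :: real assume "0 < e"
      then obtain D where D: "D \<in> \<D>" "measure M ((A - D) \<union> (D - A)) < e"
        using Compl.IH by (auto simp: approximates_def)
      have "D \<subseteq> space M" using D(1) \<D>(6) assms(3) sets.sets_into_space by blast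
      \<comment> \<open>Taking complements within \<open>space M\<close> leaves a symmetric
        difference unchanged.\<close>
      then have "(space M - A - (space M - D)) \<union> (space M - D - (space M - A))
          = (A - D) \<union> (D - A)"
        using A by blast
      then show "\<exists>D\<in>\<D>. measure M ((space M - A - D) \<union> (D - (space M - A))) < e"
        using D \<D>(4) by (intro bexI[of _ "space M - D"]) simp_all
    qed
  next
    case (Union A)
    then show ?case using \<D> assms(3) by (intro approximates_Union) auto
  qed
  then show thesis using \<D>(1,6) assms(3) by (intro that) auto
qed

text \<open>Only countably many pairs of an approximating set and a rational precision matter.\<close>

lemma countable_dense_subfamily:
  assumes \<D>: "countable \<D>" "\<D> \<subseteq> sets M" "\<forall>A\<in>sets M. approximates M \<D> A"
    and \<F>: "\<F> \<subseteq> sets M"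
  obtains \<F>' where "countable \<F>'" "\<F>' \<subseteq> \<F>" "\<forall>A\<in>\<F>. approximates M \<F>' A"
proof
  let ?near = "\<lambda>D (m::nat) A. A \<in> \<F> \<and> measure M ((A - D) \<union> (D - A)) < 1 / Suc m"
  \<comment> \<open>One member of \<open>\<F>\<close> is picked for each pair that has a member of
    \<open>\<F>\<close> nearby.\<close>
  let ?sel = "\<lambda>(D, m). SOME A. ?near D m A"
  define I where "I = {(D, m). D \<in> \<D> \<and> (\<exists>A. ?near D m A)}"
  have sel: "?near D m (?sel (D, m))" if "(D, m) \<in> I" for D m
  proof -
    have "\<exists>A. ?near D m A" using that by (simp add: I_def)
    from someI_ex[OF this] show ?thesis by simp
  qed
  have "I \<subseteq> \<D> \<times> UNIV" by (auto simp: I_def)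
  then have "countable I" by (rule countable_subset) (use \<D>(1) in simp)
  then show "countable (?sel ` I)" by (rule countable_image)
  show "?sel ` I \<subseteq> \<F>" using sel by (auto simp del: split_paired_All)
  show "\<forall>A\<in>\<F>. approximates M (?sel ` I) A"
  proof
    fix A assume A: "A \<in> \<F>"
    show "approximates M (?sel ` I) A"
      unfolding approximates_def
    proof (intro allI impI)
      fix e :: real assume "0 < e"
      \<comment> \<open>Half of \<open>e\<close> for each of the two steps, from \<open>A\<close> to
        \<open>D\<close> and from \<open>D\<close> to the selected set.\<close>
      then obtain m :: nat where m: "1 / Suc m < e / 2"
        using nat_approx_posE[of "e / 2"] by auto
      have "A \<in> sets M" using A \<F> by blast
      then have "\<exists>D\<in>\<D>. measure M ((A - D) \<union> (D - A)) < 1 / Suc m"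
        using \<D>(3) by (auto simp: approximates_def simp del: of_nat_Suc)
      then obtain D where D: "D \<in> \<D>" "measure M ((A - D) \<union> (D - A)) < 1 / Suc m" by blast
      then have I: "(D, m) \<in> I" using A by (auto simp: I_def)
      let ?B = "?sel (D, m)"
      have B: "?B \<in> \<F>" "measure M ((?B - D) \<union> (D - ?B)) < 1 / Suc m"
        using sel[OF I] by blast+
      have meas: "A \<in> sets M" "?B \<in> sets M" "D \<in> sets M" using A B(1) D(1) \<F> \<D>(2) by blast+
      have "measure M ((A - ?B) \<union> (?B - A))
          \<le> measure M (((A - D) \<union> (D - A)) \<union> ((?B - D) \<union> (D - ?B)))"
        using meas by (intro finite_measure_mono) (blast, auto)
      also have "\<dots> \<le> measure M ((A - D) \<union> (D - A)) + measure M ((?B - D) \<union> (D - ?B))"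
        using meas by (intro measure_Un_le) auto
      finally have "measure M ((A - ?B) \<union> (?B - A)) < e" using D(2) B(2) m by simp
      then show "\<exists>B\<in>?sel ` I. measure M ((A - B) \<union> (B - A)) < e" using I by blast
    qed
  qed
qed

text \<open>Approximants \<open>D n\<close> with summable errors exist. By Borel-Cantelli almost
  every point is eventually in \<open>D n\<close> exactly when it is in \<open>A\<close>, so the
  limit superior of the \<open>D n\<close> agrees with \<open>A\<close> almost everywhere, and
  completeness applies.\<close>

lemma complete_subalgebra_closed:
  assumes \<A>: "sigma_subalgebra M \<A>" "complete_subalgebra M \<A>"
    and A: "A \<in> sets M" "approximates M \<A> A"
  shows "A \<in> \<A>"
proof -
  obtain N where N: "sets N = \<A>" "space N = space M"
    using \<A>(1) by (rule sigma_subalgebra_as_measure)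
  have "\<forall>n::nat. \<exists>D\<in>\<A>. measure M ((A - D) \<union> (D - A)) < (1 / 2) ^ n"
    using A(2) by (simp add: approximates_def)
  then obtain D where D: "\<And>n. D n \<in> \<A>" "\<And>n. measure M ((A - D n) \<union> (D n - A)) < (1 / 2) ^ n"
    by metis
  have D_sets: "D n \<in> sets M" for n using D(1) \<A>(1) by (auto simp: sigma_subalgebra_def)
  have "summable (\<lambda>n. measure M ((A - D n) \<union> (D n - A)))"
    using D(2) by (intro summable_comparison_test'[OF summable_geometric[of "1 / 2 :: real"]])
      (auto intro: less_imp_le)
  then have AE: "AE x in M. \<forall>\<^sub>F n in sequentially. x \<in> space M - ((A - D n) \<union> (D n - A))"
    using A(1) D_sets by (intro borel_cantelli_AE1) (auto simp: emeasure_eq_measure)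
  have "D n \<in> sets N" for n using D(1) N(1) by simp
  then have "(\<Inter>n. \<Union>k. D (n + k)) \<in> sets N"
    by (auto intro!: sets.countable_INT sets.countable_UN)
  then have L: "(\<Inter>n. \<Union>k. D (n + k)) \<in> \<A>" using N(1) by simp
  show ?thesis
  proof (rule complete_subalgebraD[OF \<A>(2,1) L A(1)])
    show "AE x in M. x \<in> (\<Inter>n. \<Union>k. D (n + k)) \<longleftrightarrow> x \<in> A"
      using AE
    proof (rule AE_mp, intro AE_I2 impI)
      fix x assume "\<forall>\<^sub>F n in sequentially. x \<in> space M - ((A - D n) \<union> (D n - A))"
      then obtain m where m: "\<And>n. m \<le> n \<Longrightarrow> x \<in> D n \<longleftrightarrow> x \<in> A"
        by (auto simp: eventually_sequentially)
      have "x \<in> A" if x: "x \<in> (\<Inter>n. \<Union>k. D (n + k))"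
      proof -
        obtain k where "x \<in> D (m + k)" using x by blast
        then show ?thesis using m[of "m + k"] by simp
      qed
      moreover have "x \<in> (\<Union>k. D (n + k))" if "x \<in> A" for n
        using m[of "n + m"] that by auto
      ultimately show "x \<in> (\<Inter>n. \<Union>k. D (n + k)) \<longleftrightarrow> x \<in> A" by blast
    qed
  qed
qed

end

text \<open>A countable base generates the Borel sets, because every open set is a countable union
  of basic ones.\<close>

lemma standard_borel_space_countably_generated:
  assumes "standard_borel_space N"
  obtains \<B> where "countable \<B>" "\<B> \<subseteq> Pow (space N)" "sets N = sigma_sets (space N) \<B>"
proof -
  obtain X where X: "second_countable X" "topspace X = space N"
    "sets N = sigma_sets (space N) {U. openin X U}"
    using assms by (auto simp: standard_borel_space_def)
  obtain \<B> where \<B>: "countable \<B>" "\<And>V. V \<in> \<B> \<Longrightarrow> openin X V"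
    "\<And>U x. openin X U \<Longrightarrow> x \<in> U \<Longrightarrow> \<exists>V\<in>\<B>. x \<in> V \<and> V \<subseteq> U"
    using X(1) by (auto simp: second_countable_def)
  have "U \<in> sigma_sets (space N) \<B>" if "openin X U" for U
  proof -
    have "\<Union>{V \<in> \<B>. V \<subseteq> U} \<in> sigma_sets (space N) \<B>"
      using \<B>(1) by (intro sigma_sets_UNION countable_Collect) auto
    also have "\<Union>{V \<in> \<B>. V \<subseteq> U} = U" using \<B>(3)[OF that] by blast
    finally show ?thesis .
  qed
  then have "sets N = sigma_sets (space N) \<B>"
    unfolding X(3) using \<B>(2) by (intro sigma_sets_eqI) auto
  moreover have "\<B> \<subseteq> Pow (space N)" using \<B>(2) X(2) openin_subset by blast
  ultimately show thesis using \<B>(1) that by blast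
qed

text \<open>A set of the completion differs from a set of \<open>N\<close> only within a null set,
  so the approximants found for \<open>N\<close> also serve for \<open>M\<close>.\<close>

lemma standard_probability_space_approximating_family:
  assumes "standard_probability_space M"
  obtains \<D> where "countable \<D>" "\<D> \<subseteq> sets M" "\<forall>A\<in>sets M. approximates M \<D> A"
proof -
  obtain N where N: "standard_borel_space N" "prob_space N" "M = completion N"
    using assms by (auto simp: standard_probability_space_def)
  interpret N: prob_space N by fact
  obtain \<B> where "countable \<B>" "\<B> \<subseteq> Pow (space N)" "sets N = sigma_sets (space N) \<B>"
    using N(1) by (rule standard_borel_space_countably_generated)
  then obtain \<D> where \<D>: "countable \<D>" "\<D> \<subseteq> sets N" "\<forall>A\<in>sets N. approximates N \<D> A"
    by (rule N.countable_approximating_family)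
  have "approximates M \<D> A" if A: "A \<in> sets M" for A
    unfolding approximates_def
  proof (intro allI impI)
    fix e :: real assume e: "0 < e"
    obtain S Z Z' where S: "A = S \<union> Z" "Z \<subseteq> Z'" "Z' \<in> null_sets N" "S \<in> sets N"
      using A unfolding N(3) by (rule sets_completionE)
    obtain D where D: "D \<in> \<D>" "measure N ((S - D) \<union> (D - S)) < e"
      using \<D>(3) S(4) e by (auto simp: approximates_def)
    have sets: "S \<in> sets M" "D \<in> sets M" using S(4) D(1) \<D>(2) N(3) by auto
    have "AE x in M. x \<notin> Z'"
      using S(3) unfolding N(3) by (intro AE_completion AE_not_in)
    then have "measure M ((A - D) \<union> (D - A)) = measure M ((S - D) \<union> (D - S))"
      using S(1,2) A sets by (intro measure_eq_AE) auto
    also have "\<dots> = measure N ((S - D) \<union> (D - S))"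
      using S(4) D(1) \<D>(2) unfolding N(3) by (intro measure_completion) auto
    finally have "measure M ((A - D) \<union> (D - A)) < e" using D(2) by (rule ord_eq_less_trans)
    then show "\<exists>D\<in>\<D>. measure M ((A - D) \<union> (D - A)) < e" using D(1) by blast
  qed
  then show thesis using \<D>(1,2) N(3) by (intro that) auto
qed

text \<open>Countably many members of the family suffice to contain a dense subset of its union.
  Their join has zero entropy and, being closed under approximation, contains the whole
  union.\<close>

lemma zero_entropy_subalgebras_greatest:
  assumes ds: "dynamical_system G M T"
  obtains P where "P \<in> zero_entropy_subalgebras G M T"
    "\<forall>\<A>\<in>zero_entropy_subalgebras G M T. \<A> \<subseteq> P"
proof -
  interpret prob_space M using ds by (rule dynamical_system_prob_space)
  let ?Z = "zero_entropy_subalgebras G M T"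
  have Z: "sigma_subalgebra M \<A>" "complete_subalgebra M \<A>" if "\<A> \<in> ?Z" for \<A>
    using that by (auto simp: zero_entropy_subalgebras_def complete_invariant_subalgebras_def)
  then have sub: "\<Union>?Z \<subseteq> sets M" by (auto simp: sigma_subalgebra_def)
  have "standard_probability_space M" using ds by (simp add: dynamical_system_def)
  then obtain \<D> where \<D>: "countable \<D>" "\<D> \<subseteq> sets M" "\<forall>A\<in>sets M. approximates M \<D> A"
    by (rule standard_probability_space_approximating_family)
  obtain \<F> where \<F>: "countable \<F>" "\<F> \<subseteq> \<Union>?Z" "\<forall>A\<in>\<Union>?Z. approximates M \<F> A"
    using \<D> sub by (rule countable_dense_subfamily)
  have "\<forall>A\<in>\<F>. \<exists>\<A>\<in>?Z. A \<in> \<A>" using \<F>(2) by blast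
  then obtain c where c: "\<And>A. A \<in> \<F> \<Longrightarrow> c A \<in> ?Z" "\<And>A. A \<in> \<F> \<Longrightarrow> A \<in> c A" by metis
  \<comment> \<open>The inserted subalgebra makes \<open>\<Z>\<close> nonempty, so that
    \<open>from_nat_into\<close> enumerates it even when \<open>\<F>\<close> is empty.\<close>
  define \<Z> where "\<Z> = insert (generated_subalgebra G M T {space M}) (c ` \<F>)"
  have \<Z>: "countable \<Z>" "\<Z> \<noteq> {}" "\<Z> \<subseteq> ?Z"
    using \<F>(1) c(1) zero_entropy_subalgebras_nonempty[OF ds] by (auto simp: \<Z>_def)
  define P where "P = generated_subalgebra G M T (\<Union>n. from_nat_into \<Z> n)"
  have "from_nat_into \<Z> n \<in> ?Z" for n using from_nat_into[OF \<Z>(2)] \<Z>(3) by blast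
  then have P: "P \<in> ?Z" unfolding P_def by (rule countable_join_zero_entropy[OF ds])
  have "\<F> \<subseteq> \<Union>\<Z>" using c(2) by (auto simp: \<Z>_def)
  also have "\<Union>\<Z> = (\<Union>n. from_nat_into \<Z> n)" using \<Z>(1,2) by (simp add: range_from_nat_into)
  also have "\<dots> \<subseteq> P" by (auto simp: P_def generated_subalgebra_def)
  finally have \<F>P: "\<F> \<subseteq> P" .
  have "A \<in> P" if "A \<in> \<Union>?Z" for A
  proof -
    have A: "A \<in> sets M" using that sub by blast
    have "approximates M P A" using \<F>(3) that \<F>P by (fastforce simp: approximates_def)
    with Z[OF P] A show ?thesis by (rule complete_subalgebra_closed)
  qed
  then show thesis using P by (intro that) auto
qed

theorem theorem1:
  fixes G :: "('g, 'm) monoid_scheme" and M :: "'a measure" and T :: "'g \<Rightarrow> 'a \<Rightarrow> 'a"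
  assumes "dynamical_system G M T"
  shows "\<exists>!\<P>. \<P> \<in> zero_entropy_subalgebras G M T \<and>
    (\<forall>\<A>\<in>zero_entropy_subalgebras G M T. \<P> \<subseteq> \<A> \<longrightarrow> \<A> = \<P>)"
proof -
  obtain P where "P \<in> zero_entropy_subalgebras G M T"
    "\<forall>\<A>\<in>zero_entropy_subalgebras G M T. \<A> \<subseteq> P"
    using assms by (rule zero_entropy_subalgebras_greatest)
  \<comment> \<open>A greatest element is maximal, and any maximal element, being contained in it,
    equals it.\<close>
  then show ?thesis by (intro ex1I[of _ P]) (auto intro: antisym)
qed

end
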